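(* Let $A\in\mathcal{A}$. Then the following are equivalent: (a) $\mathbf{P}^{\mathfrak m}(A)=1$; (b) $\mathbf{P}\big(\{\omega:\mathfrak m(\omega,\{x\in\mathbb X:\theta_x^{-1}\omega\notin A\})=0\}\big)=1$; (c) $\mathbf{P}^{\mathfrak m}\big(\{\omega:\mathfrak m(\omega,\{x\in\mathbb X:\theta_x^{-1}\omega\notin A\})=0\}\big)=1$.
   Context: $\mathbb X$ is a locally compact second-countable Hausdorff topological group with Borel sets $\mathcal B(\mathbb X)$ and a fixed left-invariant Haar measure $\lambda$. $(\Omega,\mathcal A,\theta,\mathbf P)$ is a stationary framework on $\mathbb X$: $(\Omega,\mathcal A,\mathbf P)$ is a probability space and $\theta:\mathbb X\times\Omega\to\Omega$, $\theta_x\omega:=\theta(x,\omega)$, is a (jointly) measurable left action of $\mathbb X$ on $\Omega$ preserving $\mathbf P$. $\mathbf M$ is the space of locally finite counting measures on $\mathbb X$ with the $\sigma$-algebra generated by the maps $\mu\mapsto\mu(B)$, $B\in\mathcal B(\mathbb X)$. $\mathfrak m:\Omega\to\mathbf M$ is a simple point process (a random element of $\mathbf M$ all of whose atoms have mass $1$; it is identified with its support), which is flow-adapted: $\mathfrak m(\theta_x\omega,B)=\mathfrak m(\omega,x^{-1}B)$ for all $x\in\mathbb X$, $\omega\in\Omega$, $B\in\mathcal B(\mathbb X)$. It has finite and nonzero intensity: $\mathbf E[\mathfrak m(\cdot)]$ is locally finite and not the zero measure, and $\gamma:=\mathbf E[\mathfrak m(B)]/\lambda(B)\in(0,\infty)$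 for any $B\in\mathcal B(\mathbb X)$ with $\lambda(B)\in(0,\infty)$. The Palm probability measure of $\mathfrak m$ is $\mathbf P^{\mathfrak m}(A):=\frac1\gamma\mathbf E\int_{\mathbb X}1_{\theta_x^{-1}\omega\in A}\,w(x)\,\mathfrak m(dx)$, $A\in\mathcal A$, where $w:\mathbb X\to[0,\infty)$ is any measurable function with $\int w\,d\lambda=1$ (the definition does not depend on $w$). *)

theory Defs
  imports "HOL-Probability.Probability"
begin

text \<open>
  The group \<open>\<X>\<close> is rendered by a type of class \<^class>\<open>topological_group_add\<close>, written additively but
  not assumed to be commutative: \<open>x + y\<close> is the group product, \<open>- x\<close> the inverse and \<open>0\<close> the unit.
  Thus the translate \<open>xB\<close> is \<open>(+) x ` B\<close>, and the order of summands matters throughout.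
\<close>

text \<open>
  Regularity is not demanded of a Haar measure: in a second-countable locally compact Hausdorff
  space every Borel measure that is finite on compact sets is regular.
\<close>

locale left_haar_measure =
  fixes haar :: "'x::topological_group_add measure"
  assumes sets_haar: "sets haar = sets borel"
    and haar_compact_finite: "\<And>K. compact K \<Longrightarrow> emeasure haar K < \<infinity>"
    and haar_nonzero: "emeasure haar UNIV \<noteq> 0"
    and haar_left_invariant:
      "\<And>x B. B \<in> sets borel \<Longrightarrow> emeasure haar ((+) x ` B) = emeasure haar B"

locale stationary_framework = prob_space P
  for P :: "'w measure" +
  fixes \<theta> :: "'x::topological_group_add \<Rightarrow> 'w \<Rightarrow> 'w"
  assumes flow_measurable: "(\<lambda>(x, \<omega>). \<theta> x \<omega>) \<in> borel \<Otimes>\<^sub>M P \<rightarrow>\<^sub>M P"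
    and flow_zero: "\<And>\<omega>. \<omega> \<in> space P \<Longrightarrow> \<theta> 0 \<omega> = \<omega>"
    and flow_add: "\<And>x y \<omega>. \<omega> \<in> space P \<Longrightarrow> \<theta> (x + y) \<omega> = \<theta> x (\<theta> y \<omega>)"
    and flow_preserves: "\<And>x. distr P P (\<theta> x) = P"

definition locally_finite_counting_measure :: "'x::topological_space measure \<Rightarrow> bool" where
  "locally_finite_counting_measure \<mu> \<longleftrightarrow>
     sets \<mu> = sets borel \<and>
     (\<forall>K. compact K \<longrightarrow> emeasure \<mu> K < \<infinity>) \<and>
     (\<forall>B\<in>sets borel. emeasure \<mu> B = \<infinity> \<or> (\<exists>n::nat. emeasure \<mu> B = of_nat n))"

text \<open>The measurable space \<open>\<M>\<close>, built in the same way as \<^const>\<open>subprob_algebra\<close>.\<close>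

definition counting_measure_algebra :: "'x::topological_space measure measure" where
  "counting_measure_algebra =
     (SUP B \<in> sets borel.
        vimage_algebra (Collect locally_finite_counting_measure) (\<lambda>\<mu>. emeasure \<mu> B) borel)"

definition simple_point_process ::
    "'w measure \<Rightarrow> ('w \<Rightarrow> 'x::topological_space measure) \<Rightarrow> bool" where
  "simple_point_process P m \<longleftrightarrow>
     m \<in> P \<rightarrow>\<^sub>M counting_measure_algebra \<and>
     (\<forall>\<omega>\<in>space P. \<forall>x. emeasure (m \<omega>) {x} \<noteq> 0 \<longrightarrow> emeasure (m \<omega>) {x} = 1)"

definition flow_adapted ::
    "'w measure \<Rightarrow> ('x::topological_group_add \<Rightarrow> 'w \<Rightarrow> 'w) \<Rightarrow> ('w \<Rightarrow> 'x measure) \<Rightarrow> bool" where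
  "flow_adapted P \<theta> m \<longleftrightarrow>
     (\<forall>x. \<forall>\<omega>\<in>space P. \<forall>B\<in>sets borel.
        emeasure (m (\<theta> x \<omega>)) B = emeasure (m \<omega>) ((+) (- x) ` B))"

definition expected_count ::
    "'w measure \<Rightarrow> ('w \<Rightarrow> 'x::topological_space measure) \<Rightarrow> 'x set \<Rightarrow> ennreal" where
  "expected_count P m B = (\<integral>\<^sup>+\<omega>. emeasure (m \<omega>) B \<partial>P)"

text \<open>
  The number \<open>\<gamma> = E[m(B)] / \<lambda>(B)\<close>. It is positive, finite and the same for all \<open>B\<close> with
  \<open>0 < \<lambda>(B) < \<infinity>\<close>, by stationarity and uniqueness of Haar measure.
\<close>

definition intensity ::
    "'w measure \<Rightarrow> 'x::topological_space measure \<Rightarrow> ('w \<Rightarrow> 'x measure) \<Rightarrow> 'x set \<Rightarrow> ennreal" where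
  "intensity P haar m B = expected_count P m B / emeasure haar B"

definition finite_nonzero_intensity ::
    "'w measure \<Rightarrow> ('w \<Rightarrow> 'x::topological_space measure) \<Rightarrow> bool" where
  "finite_nonzero_intensity P m \<longleftrightarrow>
     (\<forall>K. compact K \<longrightarrow> expected_count P m K < \<infinity>) \<and>
     (\<exists>B\<in>sets borel. expected_count P m B \<noteq> 0)"

text \<open>
  As \<open>\<theta>\<close> is a group action, \<open>\<theta> (- x)\<close> is the inverse of the map \<open>\<theta> x\<close> on \<open>space P\<close>.
\<close>

definition palm_measure ::
    "'w measure \<Rightarrow> ('x::topological_group_add \<Rightarrow> 'w \<Rightarrow> 'w) \<Rightarrow> ('w \<Rightarrow> 'x measure) \<Rightarrow>
     ennreal \<Rightarrow> ('x \<Rightarrow> real) \<Rightarrow> 'w measure" where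
  "palm_measure P \<theta> m \<gamma> w = measure_of (space P) (sets P)
     (\<lambda>A. (1 / \<gamma>) * (\<integral>\<^sup>+\<omega>. (\<integral>\<^sup>+x. indicator A (\<theta> (- x) \<omega>) * ennreal (w x) \<partial>m \<omega>) \<partial>P))"

end

theory Submission
  imports Defs
begin

text \<open>
  For an event \<open>E\<close> let \<open>C\<^sub>E(D)\<close> be the expected number of points \<open>x \<in> D\<close> of the process for which
  \<open>\<theta>\<^sub>x\<^sup>-\<^sup>1\<omega> \<in> E\<close>. Stationarity makes \<open>C\<^sub>E\<close> a left-invariant measure on the group, and \<open>C\<^sub>E\<close> is finite on
  compact sets because the intensity is. By uniqueness of Haar measure
  (\<open>left_invariant_measure_unique\<close>), \<open>C\<^sub>E = c\<^sub>E \<lambda>\<close> for a finite constant \<open>c\<^sub>E\<close>.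

  This has three consequences. Integrating \<open>w\<close> gives that the Palm measure of \<open>E\<close> is \<open>c\<^sub>E / \<gamma>\<close>.
  For \<open>E = \<Omega>\<close> it gives \<open>c\<^sub>\<Omega> = \<gamma>\<close>, so \<open>0 < \<gamma> < \<infinity>\<close> and the Palm measure is a probability measure. For
  \<open>E = \<Omega> - A\<close>, the event \<open>A\<close> has Palm probability \<open>1\<close> iff \<open>c\<^sub>E = 0\<close>, iff \<open>C\<^sub>E\<close> vanishes on the
  whole group, iff almost surely no point \<open>x\<close> of the process has \<open>\<theta>\<^sub>x\<^sup>-\<^sup>1\<omega> \<notin> A\<close>. This is the
  equivalence of (a) and (b), lemma \<open>emeasure_palm_measure_eq_1_iff\<close>.

  Call \<open>x\<close> bad for \<open>A\<close> if \<open>\<theta>\<^sub>x\<^sup>-\<^sup>1\<omega> \<notin> A\<close>. The equivalence of (b) and (c) is the same lemma applied to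
  the event \<open>N\<close> that the points \<open>x\<close> of the process that are bad for \<open>A\<close> have mass \<open>0\<close>.
  As \<open>N\<close> is invariant under the flow, either every element of the group is bad for \<open>N\<close> or none is.
  So the process has no mass on what is bad for \<open>N\<close> iff \<open>\<omega> \<in> N\<close> or there are no points at all;
  and in the latter case \<open>\<omega> \<in> N\<close> too. Hence (b) for \<open>N\<close> is the same as (b) for \<open>A\<close>.

  Two tools are built on the way: uniqueness of Haar measure in the second-countable case, where it
  follows from Fubini's theorem, and measurable integration against a kernel whose values are
  locally finite measures.
\<close>

section \<open>Translates in a second-countable topological group\<close>

text \<open>
  The translates of an open set form an open cover of the group, and by the Lindelof property
  countably many of them suffice. Thus compact neighbourhoods give \<open>\<sigma>\<close>-finiteness, and a
  left-invariant measure that vanishes on a nonempty open set vanishes.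
\<close>

lemma countable_translates_cover:
  fixes V :: "'x::{topological_group_add, second_countable_topology} set"
  assumes V: "open V" "V \<noteq> {}"
  obtains C where "countable C" "(\<Union>c\<in>C. (+) (- c) -` V) = UNIV"
proof -
  have "open S" if S: "S \<in> range (\<lambda>c. (+) (- c) -` V)" for S
    using S by (auto intro!: open_vimage V continuous_intros)
  then obtain F where F: "F \<subseteq> range (\<lambda>c. (+) (- c) -` V)" "countable F"
      "\<Union>F = (\<Union>c. (+) (- c) -` V)"
    by (rule Lindelof)
  from F(1,2) obtain C where C: "countable C" "F = (\<lambda>c. (+) (- c) -` V) ` C"
    by (meson countable_subset_image)
  obtain v where v: "v \<in> V"
    using V by auto
  have "x \<in> (\<Union>c. (+) (- c) -` V)" for x
    by (rule UN_I[of "x - v"]) (simp_all add: v)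
  with C F(3) have "(\<Union>c\<in>C. (+) (- c) -` V) = UNIV"
    by auto
  with C(1) that show thesis
    by blast
qed

lemma compact_neighbourhood_of_zero:
  assumes "locally compact (UNIV :: 'x::{topological_space, zero} set)"
  obtains U K :: "'x::{topological_space, zero} set" where "open U" "0 \<in> U" "U \<subseteq> K" "compact K"
proof -
  have "openin (top_of_set UNIV) (UNIV :: 'x set)" "(0::'x) \<in> UNIV"
    by simp_all
  from locallyE[OF assms this] obtain U K :: "'x set" where
    "openin (top_of_set UNIV) U" "compact K" "0 \<in> U" "U \<subseteq> K"
    by metis
  then show thesis
    by (intro that[of U K]) simp_all
qed

lemma compact_right_translate:
  fixes K :: "'x::topological_group_add set"
  assumes "compact K"
  shows "compact ((\<lambda>y. y + x) -` K)"
proof -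
  have "(\<lambda>y. y + x) -` K = (\<lambda>y. y - x) ` K"
  proof (intro equalityI subsetI)
    fix y assume "y \<in> (\<lambda>y. y + x) -` K"
    then show "y \<in> (\<lambda>y. y - x) ` K"
      by (intro image_eqI[of _ _ "y + x"]) auto
  qed auto
  also have "compact \<dots>"
    by (intro compact_continuous_image assms continuous_intros)
  finally show ?thesis .
qed

lemma left_translate_vimage_eq_image:
  fixes x :: "'x::group_add"
  shows "(+) x -` B = (+) (- x) ` B"
proof (intro equalityI subsetI)
  fix y assume "y \<in> (+) x -` B"
  then show "y \<in> (+) (- x) ` B"
    by (intro image_eqI[of _ _ "x + y"]) auto
qed auto

lemma countable_compact_cover:
  assumes "locally compact (UNIV :: 'x::{topological_group_add, second_countable_topology} set)"
  obtains D :: "nat \<Rightarrow> 'x::{topological_group_add, second_countable_topology} set"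
  where "\<And>n. compact (D n)" "(\<Union>n. D n) = UNIV"
proof -
  obtain U K :: "'x set" where UK: "open U" "0 \<in> U" "U \<subseteq> K" "compact K"
    using compact_neighbourhood_of_zero[OF assms] .
  obtain C where C: "countable C" "(\<Union>c\<in>C. (+) (- c) -` U) = UNIV"
    using countable_translates_cover[of U] UK(1,2) by blast
  define D where "D n = (+) (- from_nat_into C n) -` K" for n
  have compact_D: "compact (D n)" for n
    unfolding D_def left_translate_vimage_eq_image
    by (intro compact_continuous_image UK(4) continuous_intros)
  have "C \<noteq> {}"
    using C(2) by auto
  then have "range (from_nat_into C) = C"
    using C(1) by (rule range_from_nat_into)
  then have "(\<Union>n. D n) = (\<Union>c\<in>C. (+) (- c) -` K)"
    unfolding D_def by (metis (no_types, lifting) image_image SUP_cong)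
  moreover have "(\<Union>c\<in>C. (+) (- c) -` U) \<subseteq> (\<Union>c\<in>C. (+) (- c) -` K)"
    by (intro UN_mono vimage_mono UK) simp
  ultimately have "(\<Union>n. D n) = UNIV"
    unfolding C(2) by (simp add: top_le)
  with compact_D show thesis
    by (rule that)
qed

lemma borel_measurable_group_uminus [measurable (raw)]:
  fixes f :: "'w \<Rightarrow> 'x::topological_group_add"
  assumes "f \<in> borel_measurable M"
  shows "(\<lambda>x. - f x) \<in> borel_measurable M"
  using assms by (rule borel_measurable_continuous_on[rotated]) (intro continuous_intros)

section \<open>Left-invariant measures and the uniqueness of Haar measure\<close>

text \<open>
  The zero measure is included: the measures \<open>C\<^sub>E\<close> to which uniqueness is applied may vanish, and
  the case in which they do is the decisive one.
\<close>

locale left_invariant_measure =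
  fixes \<mu> :: "'x::{topological_group_add, t2_space, second_countable_topology} measure"
  assumes sets_eq [measurable_cong]: "sets \<mu> = sets borel"
    and compact_finite: "\<And>K. compact K \<Longrightarrow> emeasure \<mu> K < \<infinity>"
    and distr_translate: "\<And>x. distr \<mu> borel ((+) x) = \<mu>"
begin

lemma space_eq [simp]: "space \<mu> = UNIV"
  using sets_eq_imp_space_eq[OF sets_eq] by simp

lemma nn_integral_translate:
  assumes [measurable]: "f \<in> borel_measurable borel"
  shows "(\<integral>\<^sup>+y. f (x + y) \<partial>\<mu>) = (\<integral>\<^sup>+y. f y \<partial>\<mu>)"
proof -
  have "(\<integral>\<^sup>+y. f y \<partial>\<mu>) = (\<integral>\<^sup>+y. f y \<partial>distr \<mu> borel ((+) x))"
    by (simp only: distr_translate)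
  also have "\<dots> = (\<integral>\<^sup>+y. f (x + y) \<partial>\<mu>)"
    by (subst nn_integral_distr) auto
  finally show ?thesis ..
qed

lemma sigma_finite:
  assumes "locally compact (UNIV :: 'x set)"
  shows "sigma_finite_measure \<mu>"
proof
  obtain D :: "nat \<Rightarrow> 'x set" where D: "\<And>n. compact (D n)" "(\<Union>n. D n) = UNIV"
    using countable_compact_cover[OF assms] by metis
  show "\<exists>A. countable A \<and> A \<subseteq> sets \<mu> \<and> \<Union>A = space \<mu> \<and> (\<forall>a\<in>A. emeasure \<mu> a \<noteq> \<infinity>)"
  proof (intro exI conjI)
    show "range D \<subseteq> sets \<mu>"
      using borel_compact[OF D(1)] by (auto simp: sets_eq)
    show "\<forall>a\<in>range D. emeasure \<mu> a \<noteq> \<infinity>"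
      using compact_finite[OF D(1)] by (auto simp: less_top)
  qed (simp_all add: D(2))
qed

lemma emeasure_open_pos:
  assumes "emeasure \<mu> UNIV \<noteq> 0" "open V" "V \<noteq> {}"
  shows "emeasure \<mu> V \<noteq> 0"
proof
  assume 0: "emeasure \<mu> V = 0"
  obtain C where C: "countable C" "(\<Union>c\<in>C. (+) (- c) -` V) = UNIV"
    using countable_translates_cover[OF assms(2,3)] .
  have [measurable]: "V \<in> sets borel"
    using assms(2) by simp
  have "emeasure \<mu> ((+) (- c) -` V) = 0" for c
  proof -
    have "emeasure \<mu> V = emeasure (distr \<mu> borel ((+) (- c))) V"
      by (simp only: distr_translate)
    also have "\<dots> = emeasure \<mu> ((+) (- c) -` V)"
      by (subst emeasure_distr) auto
    finally show ?thesis
      using 0 by simp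
  qed
  moreover have "(+) (- c) -` V \<in> sets \<mu>" for c
  proof -
    have "open ((+) (- c) -` V)"
      by (intro open_vimage assms continuous_intros)
    then show ?thesis
      by (simp add: sets_eq)
  qed
  ultimately have "(\<Union>c\<in>C. (+) (- c) -` V) \<in> null_sets \<mu>"
    by (intro null_sets_UN' C(1) null_setsI)
  then show False
    using assms(1) unfolding C(2) by (simp add: null_sets_def)
qed

end

lemma left_haar_measure_imp_left_invariant_measure:
  fixes haar :: "'x::{topological_group_add, t2_space, second_countable_topology} measure"
  assumes "left_haar_measure haar"
  shows "left_invariant_measure haar"
proof
  interpret left_haar_measure haar by fact
  note sets_haar [measurable_cong]
  have sp: "space haar = UNIV"
    using sets_eq_imp_space_eq[OF sets_haar] by simp
  show "sets haar = sets borel"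
    by (rule sets_haar)
  show "emeasure haar K < \<infinity>" if "compact K" for K
    using haar_compact_finite that by simp
  show "distr haar borel ((+) x) = haar" for x
  proof (rule measure_eqI)
    fix B assume "B \<in> sets (distr haar borel ((+) x))"
    then have B [measurable]: "B \<in> sets borel"
      by simp
    show "emeasure (distr haar borel ((+) x)) B = emeasure haar B"
      using haar_left_invariant[OF B, of "- x"]
      by (simp add: emeasure_distr sp left_translate_vimage_eq_image)
  qed (simp add: sets_haar)
qed

text \<open>
  Both sides are the double integral of \<open>f x * g (- y + x)\<close>. Translating \<open>y\<close> by \<open>x\<close> separates the
  variables and gives the left-hand side; translating \<open>x\<close> by \<open>y\<close> instead gives the right-hand side,
  in which the right translate of \<open>f\<close> reflects that \<open>\<nu>\<close> need not be right-invariant.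
\<close>

lemma nn_integral_left_invariant_swap:
  fixes \<mu> \<nu> :: "'x::{topological_group_add, t2_space, second_countable_topology} measure"
  assumes "locally compact (UNIV :: 'x set)"
    and "left_invariant_measure \<mu>" "left_invariant_measure \<nu>"
    and f [measurable]: "f \<in> borel_measurable borel"
    and g [measurable]: "g \<in> borel_measurable borel"
  shows "(\<integral>\<^sup>+x. f x \<partial>\<mu>) * (\<integral>\<^sup>+y. g (- y) \<partial>\<nu>) = (\<integral>\<^sup>+x. g x * (\<integral>\<^sup>+y. f (y + x) \<partial>\<nu>) \<partial>\<mu>)"
proof -
  interpret \<mu>: left_invariant_measure \<mu> by fact
  interpret \<nu>: left_invariant_measure \<nu> by fact
  interpret pair_sigma_finite \<mu> \<nu>
    using \<mu>.sigma_finite \<nu>.sigma_finite assms(1) by (simp add: pair_sigma_finite_def)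
  have *: "(\<integral>\<^sup>+y. g (- y) \<partial>\<nu>) = (\<integral>\<^sup>+y. g (- y + x) \<partial>\<nu>)" for x
    using \<nu>.nn_integral_translate[of "\<lambda>y. g (- y + x)" x] by (simp add: minus_add)
  have "(\<integral>\<^sup>+x. f x \<partial>\<mu>) * (\<integral>\<^sup>+y. g (- y) \<partial>\<nu>) = (\<integral>\<^sup>+x. f x * (\<integral>\<^sup>+y. g (- y) \<partial>\<nu>) \<partial>\<mu>)"
    by (simp add: nn_integral_multc)
  also have "\<dots> = (\<integral>\<^sup>+x. (\<integral>\<^sup>+y. f x * g (- y + x) \<partial>\<nu>) \<partial>\<mu>)"
    by (intro nn_integral_cong) (subst *, simp add: nn_integral_cmult)
  also have "\<dots> = (\<integral>\<^sup>+y. (\<integral>\<^sup>+x. f x * g (- y + x) \<partial>\<mu>) \<partial>\<nu>)"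
    by (rule Fubini'[symmetric]) measurable
  also have "\<dots> = (\<integral>\<^sup>+y. (\<integral>\<^sup>+x. f (y + x) * g x \<partial>\<mu>) \<partial>\<nu>)"
  proof (rule nn_integral_cong)
    fix y
    show "(\<integral>\<^sup>+x. f x * g (- y + x) \<partial>\<mu>) = (\<integral>\<^sup>+x. f (y + x) * g x \<partial>\<mu>)"
      using \<mu>.nn_integral_translate[of "\<lambda>x. f x * g (- y + x)" y]
      by simp
  qed
  also have "\<dots> = (\<integral>\<^sup>+x. (\<integral>\<^sup>+y. f (y + x) * g x \<partial>\<nu>) \<partial>\<mu>)"
    by (rule Fubini') measurable
  also have "\<dots> = (\<integral>\<^sup>+x. g x * (\<integral>\<^sup>+y. f (y + x) \<partial>\<nu>) \<partial>\<mu>)"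
    by (simp add: nn_integral_multc) (simp add: mult.commute)
  finally show ?thesis .
qed

text \<open>
  In \<open>nn_integral_left_invariant_swap\<close> take for \<open>f\<close> the indicator of a compact neighbourhood \<open>K\<close> of
  the unit. The factor \<open>h x\<close>, the \<open>\<nu>\<close>-measure of a right translate of \<open>K\<close>, lies strictly between
  \<open>0\<close> and \<open>\<infinity>\<close>, so \<open>g = k / h\<close> is allowed. It turns the right-hand side into the integral of \<open>k\<close>
  with respect to \<open>\<mu>\<close>, while the left-hand side is \<open>\<mu> K\<close> times a number that depends on \<open>k\<close> and
  \<open>\<nu>\<close> only. Comparing with the case \<open>\<mu> = \<nu>\<close> gives \<open>\<mu> = (\<mu> K / \<nu> K) \<nu>\<close>.
\<close>

theorem left_invariant_measure_unique:
  fixes \<mu> \<nu> :: "'x::{topological_group_add, t2_space, second_countable_topology} measure"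
  assumes lc: "locally compact (UNIV :: 'x set)"
    and \<mu>: "left_invariant_measure \<mu>" and \<nu>: "left_invariant_measure \<nu>"
    and "emeasure \<nu> UNIV \<noteq> 0"
  obtains c where "c < \<infinity>" "\<mu> = scale_measure c \<nu>"
proof -
  interpret \<mu>: left_invariant_measure \<mu> by fact
  interpret \<nu>: left_invariant_measure \<nu> by fact
  interpret sigma_finite_measure \<nu>
    using \<nu>.sigma_finite lc .
  obtain U K :: "'x set" where UK: "open U" "0 \<in> U" "U \<subseteq> K" "compact K"
    using compact_neighbourhood_of_zero[OF lc] .
  have K [measurable]: "K \<in> sets borel"
    using UK(4) by (rule borel_compact)
  define h where "h x = (\<integral>\<^sup>+y. indicator K (y + x) \<partial>\<nu>)" for x
  have h_eq: "h x = emeasure \<nu> ((\<lambda>y. y + x) -` K)" for x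
  proof -
    have "(\<lambda>y. y + x) -` K \<in> sets \<nu>"
      by (simp add: \<nu>.sets_eq borel_compact compact_right_translate UK(4))
    then have "emeasure \<nu> ((\<lambda>y. y + x) -` K) = (\<integral>\<^sup>+y. indicator ((\<lambda>y. y + x) -` K) y \<partial>\<nu>)"
      by simp
    also have "\<dots> = h x"
      unfolding h_def by (intro nn_integral_cong) (simp add: indicator_def)
    finally show ?thesis ..
  qed
  have h_fin: "h x \<noteq> top" for x
    using \<nu>.compact_finite[OF compact_right_translate[OF UK(4)]] by (simp add: h_eq less_top)
  have h_pos: "h x \<noteq> 0" for x
  proof -
    have "emeasure \<nu> ((\<lambda>y. y + x) -` U) \<noteq> 0"
    proof (rule \<nu>.emeasure_open_pos)
      show "(\<lambda>y. y + x) -` U \<noteq> {}"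
        using UK(2) by (metis empty_iff left_minus vimageI)
      show "open ((\<lambda>y. y + x) -` U)"
        by (intro open_vimage UK continuous_intros)
    qed fact
    moreover have "emeasure \<nu> ((\<lambda>y. y + x) -` U) \<le> h x"
      unfolding h_eq
    proof (rule emeasure_mono)
      show "(\<lambda>y. y + x) -` K \<in> sets \<nu>"
        by (simp add: \<nu>.sets_eq borel_compact compact_right_translate UK(4))
    qed (use UK(3) in auto)
    ultimately show ?thesis
      by auto
  qed
  have [measurable]: "h \<in> borel_measurable borel"
    unfolding h_def by measurable
  \<comment> \<open>The second factor does not depend on \<open>\<mu>'\<close>, which will be \<open>\<mu>\<close> and then \<open>\<nu>\<close>.\<close>
  have eq: "(\<integral>\<^sup>+x. k x \<partial>\<mu>') = emeasure \<mu>' K * (\<integral>\<^sup>+y. k (- y) / h (- y) \<partial>\<nu>)"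
    if \<mu>': "left_invariant_measure \<mu>'" and [measurable]: "k \<in> borel_measurable borel" for \<mu>' k
  proof -
    interpret \<mu>': left_invariant_measure \<mu>' by fact
    have "(\<integral>\<^sup>+x. indicator K x \<partial>\<mu>') * (\<integral>\<^sup>+y. k (- y) / h (- y) \<partial>\<nu>) = (\<integral>\<^sup>+x. k x / h x * h x \<partial>\<mu>')"
      using nn_integral_left_invariant_swap[OF lc \<mu>' \<nu>, of "indicator K" "\<lambda>x. k x / h x"]
      by (simp add: h_def)
    also have "\<dots> = (\<integral>\<^sup>+x. k x \<partial>\<mu>')"
      using h_fin h_pos by (simp add: ennreal_divide_times less_top)
    finally show ?thesis
      by (simp add: \<mu>'.sets_eq)
  qed
  define c where "c = emeasure \<mu> K / emeasure \<nu> K"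
  have K_fin: "emeasure \<nu> K \<noteq> top" and K_pos: "emeasure \<nu> K \<noteq> 0"
    using h_fin[of 0] h_pos[of 0] by (simp_all add: h_eq)
  show thesis
  proof
    show "c < \<infinity>"
      using \<mu>.compact_finite[OF UK(4)] K_pos
      by (simp add: c_def ennreal_divide_eq_top_iff less_top[symmetric])
    show "\<mu> = scale_measure c \<nu>"
    proof (rule measure_eqI)
      fix B assume "B \<in> sets \<mu>"
      then have [measurable]: "B \<in> sets borel"
        by (simp add: \<mu>.sets_eq)
      define I where "I = (\<integral>\<^sup>+y. indicator B (- y) / h (- y) \<partial>\<nu>)"
      have "emeasure \<mu> B = emeasure \<mu> K * I" "emeasure \<nu> B = emeasure \<nu> K * I"
        using eq[OF \<mu>, of "indicator B"] eq[OF \<nu>, of "indicator B"]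
        by (simp_all add: \<mu>.sets_eq \<nu>.sets_eq I_def)
      then show "emeasure \<mu> B = emeasure (scale_measure c \<nu>) B"
        using K_fin K_pos
        by (simp add: c_def ennreal_divide_times mult.assoc[symmetric] less_top)
    qed (simp add: \<mu>.sets_eq \<nu>.sets_eq)
  qed
qed

section \<open>Integration against locally finite kernels\<close>

text \<open>
  Restricted to \<open>K\<close> and divided by \<open>1 + L x K\<close>, the kernel becomes a subprobability kernel, for which
  measurability is known. The summand \<open>1\<close> avoids a case distinction where \<open>L x K = 0\<close>.
\<close>

lemma nn_integral_measurable_finite_kernel:
  assumes f [measurable]: "(\<lambda>(x, y). f x y) \<in> borel_measurable (M \<Otimes>\<^sub>M N)"
    and sets_L: "\<And>x. x \<in> space M \<Longrightarrow> sets (L x) = sets N"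
    and L [measurable]: "\<And>D. D \<in> sets N \<Longrightarrow> (\<lambda>x. emeasure (L x) D) \<in> borel_measurable M"
    and K [measurable]: "K \<in> sets N" and N: "space N \<noteq> {}"
    and fin: "\<And>x. x \<in> space M \<Longrightarrow> emeasure (L x) K < \<infinity>"
  shows "(\<lambda>x. \<integral>\<^sup>+y\<in>K. f x y \<partial>L x) \<in> borel_measurable M"
proof -
  define \<kappa> where "\<kappa> x = density (L x) (\<lambda>y. indicator K y / (1 + emeasure (L x) K))" for x
  have meas: "(\<lambda>y. indicator K y / (1 + emeasure (L x) K)) \<in> borel_measurable (L x)"
    if "x \<in> space M" for x
    using K sets_L[OF that] by (intro borel_measurable_divide_ennreal) auto
  have em: "emeasure (\<kappa> x) D = emeasure (L x) (K \<inter> D) / (1 + emeasure (L x) K)"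
    if "x \<in> space M" "D \<in> sets N" for x D
  proof -
    have "emeasure (\<kappa> x) D = (\<integral>\<^sup>+y. indicator (K \<inter> D) y / (1 + emeasure (L x) K) \<partial>L x)"
      unfolding \<kappa>_def using that sets_L[OF that(1)]
      by (subst emeasure_density[OF meas])
        (auto intro!: nn_integral_cong simp: indicator_def split: if_splits)
    also have "\<dots> = emeasure (L x) (K \<inter> D) / (1 + emeasure (L x) K)"
      using that K sets_L[OF that(1)] by (subst nn_integral_divide) auto
    finally show ?thesis .
  qed
  have "\<kappa> \<in> measurable M (subprob_algebra N)"
  proof (rule measurable_subprob_algebra)
    fix x assume x: "x \<in> space M"
    show "sets (\<kappa> x) = sets N"
      by (simp add: \<kappa>_def sets_L x)
    have sp: "space (\<kappa> x) = space N"
      using sets_eq_imp_space_eq[OF sets_L[OF x]] by (simp add: \<kappa>_def)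
    show "subprob_space (\<kappa> x)"
    proof
      have "emeasure (\<kappa> x) (space (\<kappa> x)) = emeasure (L x) K / (1 + emeasure (L x) K)"
        using em[OF x, of "space N"] sets.sets_into_space[OF K] by (simp add: sp Int_absorb2)
      also have "\<dots> \<le> 1"
        by (intro divide_le_posI_ennreal) (auto intro: add_pos_nonneg)
      finally show "emeasure (\<kappa> x) (space (\<kappa> x)) \<le> 1" .
      show "space (\<kappa> x) \<noteq> {}"
        by (simp add: sp N)
    qed
  next
    fix D assume D [measurable]: "D \<in> sets N"
    have "(\<lambda>x. emeasure (L x) (K \<inter> D) / (1 + emeasure (L x) K)) \<in> borel_measurable M"
      by measurable
    then show "(\<lambda>x. emeasure (\<kappa> x) D) \<in> borel_measurable M"
      by (rule measurable_cong[THEN iffD1, rotated]) (simp add: em D)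
  qed
  then have [measurable]: "(\<lambda>x. \<integral>\<^sup>+y. f x y \<partial>\<kappa> x) \<in> borel_measurable M"
    by (rule nn_integral_measurable_subprob_algebra2[OF f])
  have "(\<lambda>x. (1 + emeasure (L x) K) * (\<integral>\<^sup>+y. f x y \<partial>\<kappa> x)) \<in> borel_measurable M"
    by measurable
  then show ?thesis
  proof (rule measurable_cong[THEN iffD1, rotated])
    fix x assume x: "x \<in> space M"
    have fx: "f x \<in> borel_measurable (L x)"
      using measurable_Pair2[OF f x] sets_L[OF x] by (simp cong: measurable_cong_sets)
    have K': "K \<in> sets (L x)"
      using K sets_L[OF x] by simp
    define c where "c = 1 + emeasure (L x) K"
    have c: "c \<noteq> 0" "c \<noteq> top"
      using fin[OF x] by (auto simp: c_def)
    have "(\<integral>\<^sup>+y. f x y \<partial>\<kappa> x) = (\<integral>\<^sup>+y. f x y * indicator K y / c \<partial>L x)"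
      unfolding \<kappa>_def
      by (subst nn_integral_density[OF meas[OF x] fx])
        (simp add: c_def ennreal_times_divide mult.commute)
    also have "\<dots> = (\<integral>\<^sup>+y\<in>K. f x y \<partial>L x) / c"
      using fx K' by (intro nn_integral_divide borel_measurable_times_ennreal borel_measurable_indicator)
    finally show "(1 + emeasure (L x) K) * (\<integral>\<^sup>+y. f x y \<partial>\<kappa> x) = (\<integral>\<^sup>+y\<in>K. f x y \<partial>L x)"
      using c by (simp add: c_def[symmetric] ennreal_times_divide mult_divide_eq_ennreal mult.commute[of c])
  qed
qed

text \<open>
  The exhausting sets \<open>K n\<close> may not depend on \<open>x\<close>: the kernel is cut along them simultaneously
  for all \<open>x\<close> into countably many finite kernels.
\<close>

lemma nn_integral_measurable_kernel:
  fixes K :: "nat \<Rightarrow> 'b set"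
  assumes f: "(\<lambda>(x, y). f x y) \<in> borel_measurable (M \<Otimes>\<^sub>M N)"
    and sets_L: "\<And>x. x \<in> space M \<Longrightarrow> sets (L x) = sets N"
    and L: "\<And>D. D \<in> sets N \<Longrightarrow> (\<lambda>x. emeasure (L x) D) \<in> borel_measurable M"
    and K: "\<And>n. K n \<in> sets N" "(\<Union>n. K n) = space N"
    and N: "space N \<noteq> {}"
    and fin: "\<And>x n. x \<in> space M \<Longrightarrow> emeasure (L x) (K n) < \<infinity>"
  shows "(\<lambda>x. \<integral>\<^sup>+y. f x y \<partial>L x) \<in> borel_measurable M"
proof -
  have dK: "disjointed K n \<in> sets N" for n
    using sets.range_disjointed_sets[of K N] K(1) by auto
  have "(\<lambda>x. \<integral>\<^sup>+y\<in>disjointed K n. f x y \<partial>L x) \<in> borel_measurable M" for n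
  proof (rule nn_integral_measurable_finite_kernel[OF f sets_L L dK N])
    fix x assume x: "x \<in> space M"
    have "emeasure (L x) (disjointed K n) \<le> emeasure (L x) (K n)"
      using K(1) sets_L[OF x] by (intro emeasure_mono disjointed_subset) auto
    with fin[OF x, of n] show "emeasure (L x) (disjointed K n) < \<infinity>"
      by (simp add: le_less_trans)
  qed
  then have "(\<lambda>x. \<Sum>n. \<integral>\<^sup>+y\<in>disjointed K n. f x y \<partial>L x) \<in> borel_measurable M"
    by measurable
  then show ?thesis
  proof (rule measurable_cong[THEN iffD1, rotated])
    fix x assume x: "x \<in> space M"
    have fx: "f x \<in> borel_measurable (L x)"
      using measurable_Pair2[OF f x] sets_L[OF x] by (simp cong: measurable_cong_sets)
    have "(\<Sum>n. \<integral>\<^sup>+y\<in>disjointed K n. f x y \<partial>L x) = (\<integral>\<^sup>+y\<in>(\<Union>n. disjointed K n). f x y \<partial>L x)"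
      using dK sets_L[OF x]
      by (intro nn_integral_disjoint_family[symmetric] fx disjoint_family_disjointed) auto
    also have "\<dots> = (\<integral>\<^sup>+y. f x y \<partial>L x)"
      using sets_eq_imp_space_eq[OF sets_L[OF x]]
      by (intro nn_integral_cong) (simp add: UN_disjointed_eq K(2))
    finally show "(\<Sum>n. \<integral>\<^sup>+y\<in>disjointed K n. f x y \<partial>L x) = (\<integral>\<^sup>+y. f x y \<partial>L x)" .
  qed
qed

lemma locally_finite_counting_measure_kernel:
  fixes m :: "'w \<Rightarrow> 'x::topological_space measure"
  assumes "m \<in> P \<rightarrow>\<^sub>M counting_measure_algebra"
  shows "\<And>\<omega>. \<omega> \<in> space P \<Longrightarrow> locally_finite_counting_measure (m \<omega>)"
    and "\<And>B. B \<in> sets borel \<Longrightarrow> (\<lambda>\<omega>. emeasure (m \<omega>) B) \<in> borel_measurable P"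
proof -
  have "space (counting_measure_algebra :: 'x measure measure) = Collect locally_finite_counting_measure"
    by (auto simp: counting_measure_algebra_def space_Sup_eq_UN)
  with measurable_space[OF assms] show "\<And>\<omega>. \<omega> \<in> space P \<Longrightarrow> locally_finite_counting_measure (m \<omega>)"
    by auto
  have "(\<lambda>\<mu>. emeasure \<mu> B) \<in> borel_measurable (counting_measure_algebra :: 'x measure measure)"
    if "B \<in> sets borel" for B
    unfolding counting_measure_algebra_def using that
    by (auto intro!: measurable_Sup1 measurable_vimage_algebra1)
  from measurable_compose[OF assms this]
  show "\<And>B. B \<in> sets borel \<Longrightarrow> (\<lambda>\<omega>. emeasure (m \<omega>) B) \<in> borel_measurable P" .
qed

section \<open>The Campbell measure of a stationary point process\<close>

locale stationary_point_process = stationary_framework P \<theta>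
  for P :: "'w measure"
    and \<theta> :: "'x::{topological_group_add, t2_space, second_countable_topology} \<Rightarrow> 'w \<Rightarrow> 'w" +
  fixes m :: "'w \<Rightarrow> 'x measure"
  assumes locally_compact: "locally compact (UNIV :: 'x set)"
    and sets_m: "\<And>\<omega>. \<omega> \<in> space P \<Longrightarrow> sets (m \<omega>) = sets borel"
    and m_compact_finite: "\<And>\<omega> K. \<omega> \<in> space P \<Longrightarrow> compact K \<Longrightarrow> emeasure (m \<omega>) K < \<infinity>"
    and m_measurable: "\<And>D. D \<in> sets borel \<Longrightarrow> (\<lambda>\<omega>. emeasure (m \<omega>) D) \<in> borel_measurable P"
    and m_flow: "\<And>x \<omega> D. \<omega> \<in> space P \<Longrightarrow> D \<in> sets borel \<Longrightarrow>
      emeasure (m (\<theta> x \<omega>)) D = emeasure (m \<omega>) ((+) (- x) ` D)"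
begin

lemma flow_measurable' [measurable (raw)]:
  assumes "f \<in> borel_measurable M" "g \<in> M \<rightarrow>\<^sub>M P"
  shows "(\<lambda>z. \<theta> (f z) (g z)) \<in> M \<rightarrow>\<^sub>M P"
  using measurable_compose[OF measurable_Pair[OF assms] flow_measurable] by simp

lemma flow_space: "\<omega> \<in> space P \<Longrightarrow> \<theta> x \<omega> \<in> space P"
  using measurable_space[OF flow_measurable, of "(x, \<omega>)"] by (simp add: space_pair_measure)

lemma space_m: "\<omega> \<in> space P \<Longrightarrow> space (m \<omega>) = UNIV"
  using sets_eq_imp_space_eq[OF sets_m] by simp

lemma measurable_section:
  assumes "(\<lambda>(\<omega>, x). F \<omega> x) \<in> borel_measurable (P \<Otimes>\<^sub>M borel)" "\<omega> \<in> space P"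
  shows "F \<omega> \<in> borel_measurable (m \<omega>)"
  using measurable_Pair2[OF assms] sets_m[OF assms(2)] by (simp cong: measurable_cong_sets)

lemma measurable_nn_integral_m:
  assumes F: "(\<lambda>(\<omega>, x). F \<omega> x) \<in> borel_measurable (P \<Otimes>\<^sub>M borel)"
  shows "(\<lambda>\<omega>. \<integral>\<^sup>+x. F \<omega> x \<partial>m \<omega>) \<in> borel_measurable P"
proof -
  obtain D :: "nat \<Rightarrow> 'x set" where D: "\<And>n. compact (D n)" "(\<Union>n. D n) = UNIV"
    using countable_compact_cover[OF locally_compact] by metis
  have "emeasure (m \<omega>) (D n) < \<infinity>" if "\<omega> \<in> space P" for \<omega> n
    by (rule m_compact_finite[OF that D(1)])
  with D show ?thesis
    by (intro nn_integral_measurable_kernel[where K = D and N = borel] F sets_m m_measurable)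
      (auto intro: borel_compact)
qed

lemma nn_integral_m_flow:
  assumes \<omega>: "\<omega> \<in> space P" and f: "f \<in> borel_measurable borel"
  shows "(\<integral>\<^sup>+x. f x \<partial>m (\<theta> y \<omega>)) = (\<integral>\<^sup>+x. f (y + x) \<partial>m \<omega>)"
proof -
  have ty: "(+) y \<in> m \<omega> \<rightarrow>\<^sub>M borel"
    using sets_m[OF \<omega>] by (simp cong: measurable_cong_sets)
  have "m (\<theta> y \<omega>) = distr (m \<omega>) borel ((+) y)"
  proof (rule measure_eqI)
    show "sets (m (\<theta> y \<omega>)) = sets (distr (m \<omega>) borel ((+) y))"
      by (simp add: sets_m flow_space \<omega>)
    fix D assume "D \<in> sets (m (\<theta> y \<omega>))"
    then have D: "D \<in> sets borel"
      by (simp add: sets_m flow_space \<omega>)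
    show "emeasure (m (\<theta> y \<omega>)) D = emeasure (distr (m \<omega>) borel ((+) y)) D"
      using m_flow[OF \<omega> D] by (simp add: emeasure_distr[OF ty D] space_m[OF \<omega>] left_translate_vimage_eq_image)
  qed
  then show ?thesis
    using f by (simp add: nn_integral_distr[OF ty])
qed

text \<open>
  The Palm measure and the measures \<open>C\<^sub>E\<close> are both images of measures with a density
  with respect to this one, so countable additivity is proved only here.
\<close>

definition campbell :: "('w \<times> 'x) measure" where
  "campbell = measure_of (space P \<times> UNIV) (sets (P \<Otimes>\<^sub>M borel))
     (\<lambda>S. \<integral>\<^sup>+\<omega>. (\<integral>\<^sup>+x. indicator S (\<omega>, x) \<partial>m \<omega>) \<partial>P)"

lemma sets_campbell [measurable_cong]: "sets campbell = sets (P \<Otimes>\<^sub>M borel)"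
proof -
  have "sigma_algebra (space P \<times> UNIV) (sets (P \<Otimes>\<^sub>M (borel :: 'x measure)))"
    using sets.sigma_algebra_axioms[of "P \<Otimes>\<^sub>M (borel :: 'x measure)"] by (simp add: space_pair_measure)
  then show ?thesis
    by (simp add: campbell_def sigma_algebra.sets_measure_of_eq)
qed

lemma space_campbell [simp]: "space campbell = space P \<times> UNIV"
  using sets_eq_imp_space_eq[OF sets_campbell] by (simp add: space_pair_measure)

lemma emeasure_campbell:
  assumes "S \<in> sets (P \<Otimes>\<^sub>M borel)"
  shows "emeasure campbell S = (\<integral>\<^sup>+\<omega>. (\<integral>\<^sup>+x. indicator S (\<omega>, x) \<partial>m \<omega>) \<partial>P)"
  unfolding campbell_def
proof (rule emeasure_measure_of_sigma)
  show "sigma_algebra (space P \<times> UNIV) (sets (P \<Otimes>\<^sub>M (borel :: 'x measure)))"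
    using sets.sigma_algebra_axioms[of "P \<Otimes>\<^sub>M (borel :: 'x measure)"] by (simp add: space_pair_measure)
  show "positive (sets (P \<Otimes>\<^sub>M borel)) (\<lambda>S. \<integral>\<^sup>+\<omega>. (\<integral>\<^sup>+x. indicator S (\<omega>, x) \<partial>m \<omega>) \<partial>P)"
    by (simp add: positive_def)
  show "countably_additive (sets (P \<Otimes>\<^sub>M borel)) (\<lambda>S. \<integral>\<^sup>+\<omega>. (\<integral>\<^sup>+x. indicator S (\<omega>, x) \<partial>m \<omega>) \<partial>P)"
  proof (rule countably_additiveI)
    fix S :: "nat \<Rightarrow> ('w \<times> 'x) set"
    assume S: "range S \<subseteq> sets (P \<Otimes>\<^sub>M borel)" "disjoint_family S"
    have F: "(\<lambda>(\<omega>, x). indicator (S i) (\<omega>, x) :: ennreal) \<in> borel_measurable (P \<Otimes>\<^sub>M borel)" for i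
      using S(1) by auto
    have "(\<Sum>i. \<integral>\<^sup>+\<omega>. (\<integral>\<^sup>+x. indicator (S i) (\<omega>, x) \<partial>m \<omega>) \<partial>P) =
        (\<integral>\<^sup>+\<omega>. (\<Sum>i. \<integral>\<^sup>+x. indicator (S i) (\<omega>, x) \<partial>m \<omega>) \<partial>P)"
      by (intro nn_integral_suminf[symmetric] measurable_nn_integral_m F)
    also have "\<dots> = (\<integral>\<^sup>+\<omega>. (\<integral>\<^sup>+x. (\<Sum>i. indicator (S i) (\<omega>, x)) \<partial>m \<omega>) \<partial>P)"
      by (intro nn_integral_cong nn_integral_suminf[symmetric] measurable_section[OF F])
    also have "\<dots> = (\<integral>\<^sup>+\<omega>. (\<integral>\<^sup>+x. indicator (\<Union>i. S i) (\<omega>, x) \<partial>m \<omega>) \<partial>P)"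
      by (simp add: suminf_indicator[OF S(2)])
    finally show "(\<Sum>i. \<integral>\<^sup>+\<omega>. (\<integral>\<^sup>+x. indicator (S i) (\<omega>, x) \<partial>m \<omega>) \<partial>P) =
        (\<integral>\<^sup>+\<omega>. (\<integral>\<^sup>+x. indicator (\<Union>i. S i) (\<omega>, x) \<partial>m \<omega>) \<partial>P)" .
  qed
qed fact

lemma nn_integral_campbell:
  assumes "(\<lambda>(\<omega>, x). F \<omega> x) \<in> borel_measurable (P \<Otimes>\<^sub>M borel)"
  shows "(\<integral>\<^sup>+z. F (fst z) (snd z) \<partial>campbell) = (\<integral>\<^sup>+\<omega>. (\<integral>\<^sup>+x. F \<omega> x \<partial>m \<omega>) \<partial>P)"
proof -
  have "(\<integral>\<^sup>+z. g z \<partial>campbell) = (\<integral>\<^sup>+\<omega>. (\<integral>\<^sup>+x. g (\<omega>, x) \<partial>m \<omega>) \<partial>P)"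
    if "g \<in> borel_measurable (P \<Otimes>\<^sub>M borel)" for g :: "'w \<times> 'x \<Rightarrow> ennreal"
    using that
  proof (induction rule: borel_measurable_induct)
    case (cong f g)
    have "(\<integral>\<^sup>+z. f z \<partial>campbell) = (\<integral>\<^sup>+z. g z \<partial>campbell)"
      using cong(3) by (intro nn_integral_cong) (simp add: space_pair_measure)
    moreover have "(\<integral>\<^sup>+\<omega>. (\<integral>\<^sup>+x. f (\<omega>, x) \<partial>m \<omega>) \<partial>P) = (\<integral>\<^sup>+\<omega>. (\<integral>\<^sup>+x. g (\<omega>, x) \<partial>m \<omega>) \<partial>P)"
      using cong(3) by (intro nn_integral_cong) (simp add: space_pair_measure)
    ultimately show ?case
      using cong(4) by simp
  next
    case (set S)
    then show ?case
      by (simp add: emeasure_campbell sets_campbell)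
  next
    case (mult u c)
    then have u: "(\<lambda>(\<omega>, x). u (\<omega>, x)) \<in> borel_measurable (P \<Otimes>\<^sub>M borel)"
      by simp
    have "(\<integral>\<^sup>+\<omega>. (\<integral>\<^sup>+x. c * u (\<omega>, x) \<partial>m \<omega>) \<partial>P) = (\<integral>\<^sup>+\<omega>. c * (\<integral>\<^sup>+x. u (\<omega>, x) \<partial>m \<omega>) \<partial>P)"
      by (intro nn_integral_cong nn_integral_cmult measurable_section[OF u])
    also have "\<dots> = c * (\<integral>\<^sup>+\<omega>. (\<integral>\<^sup>+x. u (\<omega>, x) \<partial>m \<omega>) \<partial>P)"
      by (intro nn_integral_cmult measurable_nn_integral_m u)
    finally show ?case
      using mult by (simp add: nn_integral_cmult)
  next
    case (add u v)
    then have u: "(\<lambda>(\<omega>, x). u (\<omega>, x)) \<in> borel_measurable (P \<Otimes>\<^sub>M borel)"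
      and v: "(\<lambda>(\<omega>, x). v (\<omega>, x)) \<in> borel_measurable (P \<Otimes>\<^sub>M borel)"
      by simp_all
    have "(\<integral>\<^sup>+\<omega>. (\<integral>\<^sup>+x. v (\<omega>, x) + u (\<omega>, x) \<partial>m \<omega>) \<partial>P) =
        (\<integral>\<^sup>+\<omega>. (\<integral>\<^sup>+x. v (\<omega>, x) \<partial>m \<omega>) + (\<integral>\<^sup>+x. u (\<omega>, x) \<partial>m \<omega>) \<partial>P)"
      by (intro nn_integral_cong nn_integral_add measurable_section[OF u] measurable_section[OF v])
    also have "\<dots> = (\<integral>\<^sup>+\<omega>. (\<integral>\<^sup>+x. v (\<omega>, x) \<partial>m \<omega>) \<partial>P) + (\<integral>\<^sup>+\<omega>. (\<integral>\<^sup>+x. u (\<omega>, x) \<partial>m \<omega>) \<partial>P)"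
      by (intro nn_integral_add measurable_nn_integral_m u v)
    finally show ?case
      using add by (simp add: nn_integral_add)
  next
    case (seq U)
    have U: "(\<lambda>(\<omega>, x). U i (\<omega>, x)) \<in> borel_measurable (P \<Otimes>\<^sub>M borel)" for i
      using seq(1) by simp
    have inc: "incseq (\<lambda>i x. U i (\<omega>, x))" for \<omega>
      using seq(3) by (auto simp: incseq_def le_fun_def)
    have "(\<integral>\<^sup>+\<omega>. (\<integral>\<^sup>+x. (SUP i. U i (\<omega>, x)) \<partial>m \<omega>) \<partial>P) =
        (\<integral>\<^sup>+\<omega>. (SUP i. \<integral>\<^sup>+x. U i (\<omega>, x) \<partial>m \<omega>) \<partial>P)"
      by (intro nn_integral_cong nn_integral_monotone_convergence_SUP inc measurable_section[OF U])
    also have "\<dots> = (SUP i. \<integral>\<^sup>+\<omega>. (\<integral>\<^sup>+x. U i (\<omega>, x) \<partial>m \<omega>) \<partial>P)"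
      using seq(3)
      by (intro nn_integral_monotone_convergence_SUP measurable_nn_integral_m U)
        (auto simp: incseq_def le_fun_def intro!: nn_integral_mono)
    also have "\<dots> = (SUP i. \<integral>\<^sup>+z. U i z \<partial>campbell)"
      using seq.IH by simp
    also have "\<dots> = (\<integral>\<^sup>+z. (SUP i. U i z) \<partial>campbell)"
      using seq(1,3) by (intro nn_integral_monotone_convergence_SUP[symmetric]) auto
    finally show ?case
      by (simp add: image_comp)
  qed
  from this[OF assms] show ?thesis
    by (simp add: case_prod_beta)
qed

section \<open>Left invariance and the Palm measure\<close>

text \<open>
  This is the measure \<open>C\<^sub>A\<close>: the intensity measure of the process that keeps only those points \<open>x\<close>
  with \<open>\<theta> (- x) \<omega> \<in> A\<close>.
\<close>

definition thinned_intensity :: "'w set \<Rightarrow> 'x measure" where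
  "thinned_intensity A = distr (density campbell (\<lambda>z. indicator A (\<theta> (- snd z) (fst z)))) borel snd"

lemma sets_thinned_intensity [simp, measurable_cong]: "sets (thinned_intensity A) = sets borel"
  by (simp add: thinned_intensity_def)

lemma nn_integral_thinned_intensity:
  assumes A [measurable]: "A \<in> sets P" and f [measurable]: "f \<in> borel_measurable borel"
  shows "(\<integral>\<^sup>+x. f x \<partial>thinned_intensity A) =
    (\<integral>\<^sup>+\<omega>. (\<integral>\<^sup>+x. indicator A (\<theta> (- x) \<omega>) * f x \<partial>m \<omega>) \<partial>P)"
proof -
  have [measurable]: "(\<lambda>z. \<theta> (- snd z) (fst z)) \<in> campbell \<rightarrow>\<^sub>M P"
    by measurable
  have "(\<integral>\<^sup>+x. f x \<partial>thinned_intensity A) =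
      (\<integral>\<^sup>+z. indicator A (\<theta> (- snd z) (fst z)) * f (snd z) \<partial>campbell)"
    unfolding thinned_intensity_def by (simp add: nn_integral_distr nn_integral_density)
  also have "\<dots> = (\<integral>\<^sup>+\<omega>. (\<integral>\<^sup>+x. indicator A (\<theta> (- x) \<omega>) * f x \<partial>m \<omega>) \<partial>P)"
    by (rule nn_integral_campbell) measurable
  finally show ?thesis .
qed

lemma measurable_orbit_preimage:
  assumes A [measurable]: "A \<in> sets P" and [measurable]: "\<omega> \<in> space P"
  shows "{x. \<theta> (- x) \<omega> \<in> A} \<in> sets borel"
proof -
  have "Measurable.pred borel (\<lambda>x. \<theta> (- x) \<omega> \<in> A)"
    by measurable
  then show ?thesis
    by (simp add: pred_def)
qed

lemma emeasure_thinned_intensity: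
  assumes A: "A \<in> sets P" and D: "D \<in> sets borel"
  shows "emeasure (thinned_intensity A) D =
    (\<integral>\<^sup>+\<omega>. emeasure (m \<omega>) ({x. \<theta> (- x) \<omega> \<in> A} \<inter> D) \<partial>P)"
proof -
  have "emeasure (thinned_intensity A) D = (\<integral>\<^sup>+x. indicator D x \<partial>thinned_intensity A)"
    using D by simp
  also have "\<dots> = (\<integral>\<^sup>+\<omega>. (\<integral>\<^sup>+x. indicator A (\<theta> (- x) \<omega>) * indicator D x \<partial>m \<omega>) \<partial>P)"
    using D by (intro nn_integral_thinned_intensity A) simp
  also have "\<dots> = (\<integral>\<^sup>+\<omega>. emeasure (m \<omega>) ({x. \<theta> (- x) \<omega> \<in> A} \<inter> D) \<partial>P)"
  proof (rule nn_integral_cong)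
    fix \<omega> assume \<omega>: "\<omega> \<in> space P"
    have "(\<integral>\<^sup>+x. indicator A (\<theta> (- x) \<omega>) * indicator D x \<partial>m \<omega>) =
        (\<integral>\<^sup>+x. indicator ({x. \<theta> (- x) \<omega> \<in> A} \<inter> D) x \<partial>m \<omega>)"
      by (intro nn_integral_cong) (simp add: indicator_def)
    also have "\<dots> = emeasure (m \<omega>) ({x. \<theta> (- x) \<omega> \<in> A} \<inter> D)"
      using measurable_orbit_preimage[OF A \<omega>] D by (intro nn_integral_indicator) (simp add: sets_m \<omega>)
    finally show "(\<integral>\<^sup>+x. indicator A (\<theta> (- x) \<omega>) * indicator D x \<partial>m \<omega>) =
        emeasure (m \<omega>) ({x. \<theta> (- x) \<omega> \<in> A} \<inter> D)" .
  qed
  finally show ?thesis .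
qed

lemma measurable_emeasure_orbit_preimage:
  assumes A [measurable]: "A \<in> sets P"
  shows "(\<lambda>\<omega>. emeasure (m \<omega>) {x. \<theta> (- x) \<omega> \<in> A}) \<in> borel_measurable P"
proof -
  have "(\<lambda>\<omega>. \<integral>\<^sup>+x. indicator A (\<theta> (- x) \<omega>) \<partial>m \<omega>) \<in> borel_measurable P"
    by (rule measurable_nn_integral_m) measurable
  then show ?thesis
  proof (rule measurable_cong[THEN iffD1, rotated])
    fix \<omega> assume \<omega>: "\<omega> \<in> space P"
    have "(\<integral>\<^sup>+x. indicator A (\<theta> (- x) \<omega>) \<partial>m \<omega>) = (\<integral>\<^sup>+x. indicator {x. \<theta> (- x) \<omega> \<in> A} x \<partial>m \<omega>)"
      by (intro nn_integral_cong) (simp add: indicator_def)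
    also have "\<dots> = emeasure (m \<omega>) {x. \<theta> (- x) \<omega> \<in> A}"
      using measurable_orbit_preimage[OF A \<omega>] by (intro nn_integral_indicator) (simp add: sets_m \<omega>)
    finally show "(\<integral>\<^sup>+x. indicator A (\<theta> (- x) \<omega>) \<partial>m \<omega>) = emeasure (m \<omega>) {x. \<theta> (- x) \<omega> \<in> A}" .
  qed
qed

text \<open>
  Replacing \<open>\<omega>\<close> by \<open>\<theta> y \<omega>\<close> does not change the expectation, translates every point by \<open>y\<close>, and does
  not affect which points are kept: the point \<open>x\<close> of \<open>\<omega>\<close> becomes the point \<open>y + x\<close> of \<open>\<theta> y \<omega>\<close>, and
  \<open>\<theta> (- (y + x)) (\<theta> y \<omega>) = \<theta> (- x) \<omega>\<close>.
\<close>

lemma left_invariant_thinned_intensity: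
  assumes A [measurable]: "A \<in> sets P"
    and fin: "\<And>K. compact K \<Longrightarrow> expected_count P m K < \<infinity>"
  shows "left_invariant_measure (thinned_intensity A)"
proof
  show "sets (thinned_intensity A) = sets borel"
    by simp
  show "emeasure (thinned_intensity A) K < \<infinity>" if "compact K" for K
  proof -
    have "emeasure (thinned_intensity A) K \<le> expected_count P m K"
      unfolding emeasure_thinned_intensity[OF A borel_compact[OF that]] expected_count_def
      using borel_compact[OF that] by (intro nn_integral_mono emeasure_mono) (auto simp: sets_m)
    then show ?thesis
      using fin[OF that] by (rule le_less_trans)
  qed
  show "distr (thinned_intensity A) borel ((+) y) = thinned_intensity A" for y
  proof (rule measure_eqI)
    fix D assume "D \<in> sets (distr (thinned_intensity A) borel ((+) y))"
    then have D [measurable]: "D \<in> sets borel"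
      by simp
    define G where "G \<omega> = (\<integral>\<^sup>+x. indicator A (\<theta> (- x) \<omega>) * indicator D x \<partial>m \<omega>)" for \<omega>
    have G [measurable]: "G \<in> borel_measurable P"
      unfolding G_def by (rule measurable_nn_integral_m) measurable
    have \<theta>y: "\<theta> y \<in> P \<rightarrow>\<^sub>M P"
      by measurable
    have "emeasure (thinned_intensity A) D = (\<integral>\<^sup>+x. indicator D x \<partial>thinned_intensity A)"
      by simp
    also have "\<dots> = (\<integral>\<^sup>+\<omega>. G \<omega> \<partial>P)"
      unfolding G_def by (rule nn_integral_thinned_intensity) measurable
    also have "\<dots> = (\<integral>\<^sup>+\<omega>. G \<omega> \<partial>distr P P (\<theta> y))"
      by (simp only: flow_preserves)
    also have "\<dots> = (\<integral>\<^sup>+\<omega>. G (\<theta> y \<omega>) \<partial>P)"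
      by (simp add: nn_integral_distr[OF \<theta>y])
    also have "\<dots> = (\<integral>\<^sup>+\<omega>. (\<integral>\<^sup>+x. indicator A (\<theta> (- x) \<omega>) * indicator D (y + x) \<partial>m \<omega>) \<partial>P)"
    proof (rule nn_integral_cong)
      fix \<omega> assume \<omega> [measurable]: "\<omega> \<in> space P"
      have [measurable]: "\<theta> y \<omega> \<in> space P"
        by (rule flow_space[OF \<omega>])
      have "G (\<theta> y \<omega>) =
          (\<integral>\<^sup>+x. indicator A (\<theta> (- (y + x)) (\<theta> y \<omega>)) * indicator D (y + x) \<partial>m \<omega>)"
        unfolding G_def by (rule nn_integral_m_flow[OF \<omega>]) measurable
      also have "\<dots> = (\<integral>\<^sup>+x. indicator A (\<theta> (- x) \<omega>) * indicator D (y + x) \<partial>m \<omega>)"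
        by (simp add: flow_add[OF \<omega>, symmetric] minus_add)
      finally show "G (\<theta> y \<omega>) = (\<integral>\<^sup>+x. indicator A (\<theta> (- x) \<omega>) * indicator D (y + x) \<partial>m \<omega>)" .
    qed
    also have "\<dots> = (\<integral>\<^sup>+x. indicator D (y + x) \<partial>thinned_intensity A)"
      by (rule nn_integral_thinned_intensity[symmetric]) measurable
    also have "\<dots> = (\<integral>\<^sup>+x. indicator D x \<partial>distr (thinned_intensity A) borel ((+) y))"
      by (subst nn_integral_distr) simp_all
    also have "\<dots> = emeasure (distr (thinned_intensity A) borel ((+) y)) D"
      by (rule nn_integral_indicator) simp
    finally show "emeasure (distr (thinned_intensity A) borel ((+) y)) D =
        emeasure (thinned_intensity A) D" ..
  qed simp
qed

text \<open>
  \<open>palm_measure\<close> is given by \<^const>\<open>measure_of\<close>, whose value is meaningful only for a set function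
  that is a measure. This one is, being a multiple of the image under \<open>(\<omega>, x) \<mapsto> \<theta> (- x) \<omega>\<close>
  of the Campbell measure weighted by \<open>w\<close>.
\<close>

lemma
  fixes w :: "'x \<Rightarrow> real"
  assumes w [measurable]: "w \<in> borel_measurable borel"
  shows sets_palm_measure: "sets (palm_measure P \<theta> m \<gamma> w) = sets P"
    and emeasure_palm_measure: "A \<in> sets P \<Longrightarrow>
      emeasure (palm_measure P \<theta> m \<gamma> w) A = 1 / \<gamma> * (\<integral>\<^sup>+x. ennreal (w x) \<partial>thinned_intensity A)"
proof -
  define Q where "Q = scale_measure (1 / \<gamma>)
    (distr (density campbell (\<lambda>z. ennreal (w (snd z)))) P (\<lambda>z. \<theta> (- snd z) (fst z)))"
  have sets_Q: "sets Q = sets P" and space_Q: "space Q = space P"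
    by (simp add: Q_def) (rule sets_eq_imp_space_eq, simp add: Q_def)
  have [measurable]: "(\<lambda>z. \<theta> (- snd z) (fst z)) \<in> campbell \<rightarrow>\<^sub>M P"
    by measurable
  have Q: "emeasure Q A = 1 / \<gamma> * (\<integral>\<^sup>+x. ennreal (w x) \<partial>thinned_intensity A)"
    if [measurable]: "A \<in> sets P" for A
  proof -
    have "emeasure (distr (density campbell (\<lambda>z. ennreal (w (snd z)))) P (\<lambda>z. \<theta> (- snd z) (fst z))) A =
        (\<integral>\<^sup>+\<omega>. indicator A \<omega> \<partial>distr (density campbell (\<lambda>z. ennreal (w (snd z)))) P (\<lambda>z. \<theta> (- snd z) (fst z)))"
      using that by simp
    also have "\<dots> = (\<integral>\<^sup>+z. indicator A (\<theta> (- snd z) (fst z)) * ennreal (w (snd z)) \<partial>campbell)"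
      by (subst nn_integral_distr) (simp_all add: nn_integral_density mult.commute)
    also have "\<dots> = (\<integral>\<^sup>+\<omega>. (\<integral>\<^sup>+x. indicator A (\<theta> (- x) \<omega>) * ennreal (w x) \<partial>m \<omega>) \<partial>P)"
      by (rule nn_integral_campbell) measurable
    also have "\<dots> = (\<integral>\<^sup>+x. ennreal (w x) \<partial>thinned_intensity A)"
      by (rule nn_integral_thinned_intensity[symmetric]) measurable
    finally show ?thesis
      by (simp add: Q_def)
  qed
  have "palm_measure P \<theta> m \<gamma> w = measure_of (space P) (sets P) (emeasure Q)"
    unfolding palm_measure_def
  proof (rule measure_of_eq)
    fix A assume "A \<in> sigma_sets (space P) (sets P)"
    then have A: "A \<in> sets P"
      by (simp add: sets.sigma_sets_eq)
    show "1 / \<gamma> * (\<integral>\<^sup>+\<omega>. (\<integral>\<^sup>+x. indicator A (\<theta> (- x) \<omega>) * ennreal (w x) \<partial>m \<omega>) \<partial>P) = emeasure Q A"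
      unfolding Q[OF A] by (subst nn_integral_thinned_intensity[OF A]) simp_all
  qed (rule sets.space_closed)
  also have "\<dots> = Q"
    using measure_of_of_measure[of Q] by (simp add: sets_Q space_Q)
  finally have *: "palm_measure P \<theta> m \<gamma> w = Q" .
  show "sets (palm_measure P \<theta> m \<gamma> w) = sets P"
    by (simp add: * sets_Q)
  show "A \<in> sets P \<Longrightarrow>
      emeasure (palm_measure P \<theta> m \<gamma> w) A = 1 / \<gamma> * (\<integral>\<^sup>+x. ennreal (w x) \<partial>thinned_intensity A)"
    by (simp add: * Q)
qed

text \<open>
  The number \<open>c\<close> in \<open>C\<^sub>E = c haar\<close> can be read off from the weight \<open>w\<close> and also from the whole group:
  for \<open>E = space P - A\<close> the first reading makes \<open>c = 0\<close> equivalent to \<open>A\<close> having Palm probability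
  \<open>1\<close>, the second to the almost sure absence of points \<open>x\<close> with \<open>\<theta> (- x) \<omega> \<notin> A\<close>.
\<close>

lemma emeasure_palm_measure_eq_1_iff:
  fixes w :: "'x \<Rightarrow> real"
  assumes haar: "left_haar_measure haar"
    and intensity: "finite_nonzero_intensity P m"
    and B: "B \<in> sets borel" "0 < emeasure haar B" "emeasure haar B < \<infinity>"
    and \<gamma>: "\<gamma> = intensity P haar m B"
    and w [measurable]: "w \<in> borel_measurable borel"
    and w1: "(\<integral>\<^sup>+x. ennreal (w x) \<partial>haar) = 1"
    and A: "A \<in> sets P"
  shows "emeasure (palm_measure P \<theta> m \<gamma> w) A = 1 \<longleftrightarrow>
    (AE \<omega> in P. emeasure (m \<omega>) {x. \<theta> (- x) \<omega> \<notin> A} = 0)"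
proof -
  define Q where "Q = palm_measure P \<theta> m \<gamma> w"
  interpret haar: left_invariant_measure haar
    by (rule left_haar_measure_imp_left_invariant_measure[OF haar])
  have haar0: "emeasure haar UNIV \<noteq> 0"
    using haar by (simp add: left_haar_measure_def)
  have fin: "\<And>K. compact K \<Longrightarrow> expected_count P m K < \<infinity>"
    using intensity by (simp add: finite_nonzero_intensity_def)
  have sets_Q: "sets Q = sets P"
    unfolding Q_def by (rule sets_palm_measure[OF w])
  have scale: "\<exists>c<\<infinity>. thinned_intensity E = scale_measure c haar \<and> emeasure Q E = 1 / \<gamma> * c"
    if E: "E \<in> sets P" for E
  proof -
    obtain c where c: "c < \<infinity>" "thinned_intensity E = scale_measure c haar"
      using left_invariant_measure_unique[OF locally_compact
          left_invariant_thinned_intensity[OF E fin] haar.left_invariant_measure_axioms haar0] .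
    have "emeasure Q E = 1 / \<gamma> * (c * (\<integral>\<^sup>+x. ennreal (w x) \<partial>haar))"
      unfolding Q_def emeasure_palm_measure[OF w E] c(2)
      by (subst nn_integral_scale_measure) simp_all
    with c w1 show ?thesis
      by auto
  qed
  have count: "emeasure (thinned_intensity (space P)) D = expected_count P m D"
    if "D \<in> sets borel" for D
    unfolding emeasure_thinned_intensity[OF sets.top that] expected_count_def
    by (intro nn_integral_cong) (simp add: flow_space Int_def)
  \<comment> \<open>With every point kept, the constant is \<open>\<gamma>\<close>, which is therefore positive and finite.\<close>
  obtain c where c: "c < \<infinity>" "thinned_intensity (space P) = scale_measure c haar"
      "emeasure Q (space P) = 1 / \<gamma> * c"
    using scale[OF sets.top] by blast
  have "\<gamma> = c * emeasure haar B / emeasure haar B"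
    using count[OF B(1)] by (simp add: \<gamma> intensity_def c(2))
  then have "\<gamma> = c"
    using B by (simp add: ennreal_mult_divide_eq less_top)
  moreover have "c \<noteq> 0"
    using intensity count by (auto simp: finite_nonzero_intensity_def c(2))
  ultimately have \<gamma>_fin: "\<gamma> < top" and "emeasure Q (space P) = 1"
    using c by (simp_all add: ennreal_divide_times)
  then have "prob_space Q"
    using sets_eq_imp_space_eq[OF sets_Q] by (intro prob_spaceI) simp
  then interpret Q: prob_space Q .
  have E: "space P - A \<in> sets P"
    using A by simp
  obtain d where d: "thinned_intensity (space P - A) = scale_measure d haar"
      "emeasure Q (space P - A) = 1 / \<gamma> * d"
    using scale[OF E] by blast
  have "emeasure Q A = 1 \<longleftrightarrow> emeasure Q (space P - A) = 0"
    using Q.prob_compl[of A] A sets_eq_imp_space_eq[OF sets_Q]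
    by (auto simp: sets_Q Q.emeasure_eq_measure)
  also have "\<dots> \<longleftrightarrow> d = 0"
    using \<gamma>_fin by (auto simp: d(2) ennreal_divide_times)
  also have "\<dots> \<longleftrightarrow> emeasure (thinned_intensity (space P - A)) UNIV = 0"
    using haar0 by (simp add: d(1))
  also have "\<dots> \<longleftrightarrow> (\<integral>\<^sup>+\<omega>. emeasure (m \<omega>) {x. \<theta> (- x) \<omega> \<in> space P - A} \<partial>P) = 0"
    using emeasure_thinned_intensity[OF E, of UNIV] by simp
  also have "\<dots> \<longleftrightarrow> (AE \<omega> in P. emeasure (m \<omega>) {x. \<theta> (- x) \<omega> \<in> space P - A} = 0)"
    by (rule nn_integral_0_iff_AE[OF measurable_emeasure_orbit_preimage[OF E]])
  also have "\<dots> \<longleftrightarrow> (AE \<omega> in P. emeasure (m \<omega>) {x. \<theta> (- x) \<omega> \<notin> A} = 0)"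
    by (rule AE_cong) (simp add: flow_space)
  finally show ?thesis
    unfolding Q_def .
qed

text \<open>
  The flow by \<open>y\<close> translates by \<open>y\<close> both the points of the process and the set of bad positions.
\<close>

lemma emeasure_bad_positions_flow_invariant:
  assumes A: "A \<in> sets P" and \<omega>: "\<omega> \<in> space P"
  shows "emeasure (m (\<theta> y \<omega>)) {x. \<theta> (- x) (\<theta> y \<omega>) \<notin> A} = emeasure (m \<omega>) {x. \<theta> (- x) \<omega> \<notin> A}"
proof -
  have E: "space P - A \<in> sets P"
    using A by simp
  have S: "{x. \<theta> (- x) \<omega>' \<notin> A} = {x. \<theta> (- x) \<omega>' \<in> space P - A}" if "\<omega>' \<in> space P" for \<omega>'
    using that by (simp add: flow_space)
  let ?S = "{x. \<theta> (- x) (\<theta> y \<omega>) \<notin> A}"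
  have D: "?S \<in> sets borel"
    unfolding S[OF flow_space[OF \<omega>]] by (rule measurable_orbit_preimage[OF E flow_space[OF \<omega>]])
  have "emeasure (m (\<theta> y \<omega>)) ?S = emeasure (m \<omega>) ((+) (- y) ` ?S)"
    by (rule m_flow[OF \<omega> D])
  also have "(+) (- y) ` ?S = {x. \<theta> (- x) \<omega> \<notin> A}"
  proof (intro equalityI subsetI)
    fix z assume "z \<in> (+) (- y) ` ?S"
    then show "z \<in> {x. \<theta> (- x) \<omega> \<notin> A}"
      by (auto simp: flow_add[OF \<omega>, symmetric] minus_add)
  next
    fix z assume "z \<in> {x. \<theta> (- x) \<omega> \<notin> A}"
    then show "z \<in> (+) (- y) ` ?S"
      by (intro image_eqI[of _ _ "y + z"]) (auto simp: flow_add[OF \<omega>, symmetric] minus_add)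
  qed
  finally show ?thesis .
qed

end

theorem theorem1p1:
  fixes P :: "'w measure"
    and haar :: "'x::{topological_group_add, t2_space, second_countable_topology} measure"
    and \<theta> :: "'x \<Rightarrow> 'w \<Rightarrow> 'w"
    and m :: "'w \<Rightarrow> 'x measure"
    and w :: "'x \<Rightarrow> real"
    and B :: "'x set"
    and \<gamma> :: ennreal
    and A :: "'w set"
  assumes "locally compact (UNIV :: 'x set)"
    and "left_haar_measure haar"
    and "stationary_framework P \<theta>"
    and "simple_point_process P m"
    and "flow_adapted P \<theta> m"
    and "finite_nonzero_intensity P m"
    and "B \<in> sets borel" and "0 < emeasure haar B" and "emeasure haar B < \<infinity>"
    and "\<gamma> = intensity P haar m B"
    and "w \<in> borel_measurable borel" and "\<And>x. 0 \<le> w x"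
    and "(\<integral>\<^sup>+x. ennreal (w x) \<partial>haar) = 1"
    and "A \<in> sets P"
  shows "(emeasure (palm_measure P \<theta> m \<gamma> w) A = 1 \<longleftrightarrow>
            emeasure P {\<omega> \<in> space P. emeasure (m \<omega>) {x. \<theta> (- x) \<omega> \<notin> A} = 0} = 1) \<and>
         (emeasure P {\<omega> \<in> space P. emeasure (m \<omega>) {x. \<theta> (- x) \<omega> \<notin> A} = 0} = 1 \<longleftrightarrow>
            emeasure (palm_measure P \<theta> m \<gamma> w)
              {\<omega> \<in> space P. emeasure (m \<omega>) {x. \<theta> (- x) \<omega> \<notin> A} = 0} = 1)"
proof -
  interpret stationary_framework P \<theta>
    by fact
  have m: "m \<in> P \<rightarrow>\<^sub>M counting_measure_algebra"
    using assms(4) by (simp add: simple_point_process_def)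
  interpret stationary_point_process P \<theta> m
  proof
    show "locally compact (UNIV :: 'x set)"
      by fact
    show "\<And>\<omega>. \<omega> \<in> space P \<Longrightarrow> sets (m \<omega>) = sets borel"
      and "\<And>\<omega> K. \<omega> \<in> space P \<Longrightarrow> compact K \<Longrightarrow> emeasure (m \<omega>) K < \<infinity>"
      using locally_finite_counting_measure_kernel(1)[OF m]
      by (simp_all add: locally_finite_counting_measure_def)
    show "\<And>D. D \<in> sets borel \<Longrightarrow> (\<lambda>\<omega>. emeasure (m \<omega>) D) \<in> borel_measurable P"
      by (rule locally_finite_counting_measure_kernel(2)[OF m])
    show "\<And>x \<omega> D. \<omega> \<in> space P \<Longrightarrow> D \<in> sets borel \<Longrightarrow>
        emeasure (m (\<theta> x \<omega>)) D = emeasure (m \<omega>) ((+) (- x) ` D)"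
      using assms(5) by (simp add: flow_adapted_def)
  qed
  define N where "N = {\<omega> \<in> space P. emeasure (m \<omega>) {x. \<theta> (- x) \<omega> \<notin> A} = 0}"
  have "(\<lambda>\<omega>. emeasure (m \<omega>) {x. \<theta> (- x) \<omega> \<in> space P - A}) \<in> borel_measurable P"
    using assms(14) by (intro measurable_emeasure_orbit_preimage) simp
  then have "{\<omega> \<in> space P. emeasure (m \<omega>) {x. \<theta> (- x) \<omega> \<in> space P - A} = 0} \<in> sets P"
    by measurable
  also have "{\<omega> \<in> space P. emeasure (m \<omega>) {x. \<theta> (- x) \<omega> \<in> space P - A} = 0} = N"
    unfolding N_def by (intro Collect_cong conj_cong refl) (simp add: flow_space)
  finally have N: "N \<in> sets P" .
  note palm_iff = emeasure_palm_measure_eq_1_iff[OF assms(2,6-11,13)]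
  have N_iff: "emeasure P N = 1 \<longleftrightarrow> (AE \<omega> in P. emeasure (m \<omega>) {x. \<theta> (- x) \<omega> \<notin> A} = 0)"
    using N AE_iff_emeasure_eq_1[of "\<lambda>\<omega>. emeasure (m \<omega>) {x. \<theta> (- x) \<omega> \<notin> A} = 0"]
    by (simp add: N_def pred_def)
  have "emeasure (palm_measure P \<theta> m \<gamma> w) A = 1 \<longleftrightarrow> emeasure P N = 1"
    unfolding N_iff by (rule palm_iff[OF assms(14)])
  moreover have "emeasure (palm_measure P \<theta> m \<gamma> w) N = 1 \<longleftrightarrow> emeasure P N = 1"
  proof -
    \<comment> \<open>By invariance of \<open>N\<close>, the bad positions for \<open>N\<close> are the empty set or the whole group.\<close>
    have "emeasure (m \<omega>) {x. \<theta> (- x) \<omega> \<notin> N} = 0 \<longleftrightarrow>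
        emeasure (m \<omega>) {x. \<theta> (- x) \<omega> \<notin> A} = 0" if \<omega>: "\<omega> \<in> space P" for \<omega>
    proof (cases "\<omega> \<in> N")
      case True
      then have "{x. \<theta> (- x) \<omega> \<notin> N} = {}"
        using emeasure_bad_positions_flow_invariant[OF assms(14) \<omega>] by (simp add: N_def flow_space)
      then show ?thesis
        using True by (simp add: N_def)
    next
      case False
      then have "{x. \<theta> (- x) \<omega> \<notin> N} = UNIV"
        using emeasure_bad_positions_flow_invariant[OF assms(14) \<omega>] \<omega> by (simp add: N_def flow_space)
      moreover have "emeasure (m \<omega>) {x. \<theta> (- x) \<omega> \<notin> A} \<le> emeasure (m \<omega>) UNIV"
        by (rule emeasure_mono) (simp_all add: sets_m \<omega>)
      ultimately show ?thesis
        using False \<omega> by (auto simp: N_def)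
    qed
    then show ?thesis
      unfolding N_iff palm_iff[OF N] by (intro AE_cong)
  qed
  ultimately show ?thesis
    unfolding N_def by blast
qed

end
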